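(* Let $\Theta=(\Gamma,(x_{k,i}))$ be a patch framework in $\mathbb{R}^d$ with $m$ views, with $\Gamma$ connected and with every view affinely non-degenerate. Let $S$ be a perfect alignment. If $S$ is non-degenerate then $\mathrm{rank}(\overline{B(S)}_{A,B})\ge d-1$ for all non-empty partitions $A$ and $B$ of $\{1,\dots,m\}$, i.e. for all $A,B\subseteq\{1,\dots,m\}$ with $A,B\ne\emptyset$, $A\cap B=\emptyset$ and $A\cup B=\{1,\dots,m\}$.
   Context: Patch framework. $\Gamma$ is a bipartite graph on $n+m$ vertices; vertex $k\in\{1,\dots,n\}$ represents the $k$th point and vertex $n+i$, $i\in\{1,\dots,m\}$, the $i$th view; $(k,i)\in E(\Gamma)$ means that point $k$ is in view $i$, with local coordinates $x_{k,i}\in\mathbb{R}^d$. The tuple $\Theta=(\Gamma,(x_{k,i}))$ is a patch framework. A view $i$ is affinely non-degenerate if it has at least $d+1$ points and the affine span of $\{x_{k,i}:(k,i)\in E(\Gamma)\}$ has dimension $d$. Put $e_{ki}=e_k-e_{n+i}\in\mathbb{R}^{n+m}$, $\varepsilon_i$ the $i$th standard basis vector of $\mathbb{R}^m$, $\mathcal{L}_\Gamma=\sum_{(k,i)\in E(\Gamma)}e_{ki}e_{ki}^T$, $\mathbf{B}=\sum_{(k,i)\in E(\Gamma)}(\varepsilon_i\otimes I_d)x_{k,i}e_{ki}^T$, $D=\sum_{(k,i)\in E(\Gamma)}(\varepsilon_i\otimes I_d)x_{k,i}x_{k,i}^T(\varepsilon_i\otimes I_d)^T$, and $C=D-\mathbf{B}\mathcal{L}_\Gamma^\dagger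 \mathbf{B}^T\in\mathbb{R}^{md\times md}$ (positive semi-definite), where $\dagger$ is the Moore–Penrose pseudoinverse. An alignment is an element $S=[S_i]_1^m$ (vertical stack) of $\mathbb{O}(d)^m\subseteq\mathbb{R}^{md\times d}$; $F(S)=\mathrm{Tr}(CSS^T)$; $S$ is perfect if $F(S)=0$. Let $\pi:\mathbb{O}(d)^m\to\mathbb{O}(d)^{m-1}$, $\pi(S)=[S_{i+1}S_1^T]_{i=1}^{m-1}$ (identifying $\mathbb{O}(d)^m/_\sim$, $S\sim SQ$ for $Q\in\mathbb{O}(d)$, with $\mathbb{O}(d)^{m-1}$), and $\widetilde F:\mathbb{O}(d)^{m-1}\to\mathbb{R}$, $\widetilde F(\widetilde S)=\mathrm{Tr}\left(C\begin{bmatrix}I_d\\ \widetilde S\end{bmatrix}\begin{bmatrix}I_d\\ \widetilde S\end{bmatrix}^T\right)$. $S$ is non-degenerate if $\pi(S)$ is a local minimizer of $\widetilde F$ at which the Hessian is non-singular (at a critical point this does not depend on the Riemannian metric). Overlaps. For an alignment $S$ let $H=S^T\mathbf{B}\mathcal{L}_\Gamma^\dagger(I_{n+m}-n^{-1}\mathbf{1}^{n+m}_n\mathbf{1}_{n+m}^T)\in\mathbb{R}^{d\times(n+m)}$, where $\mathbf{1}^{n+m}_n$ has first $n$ entries $1$ and the rest $0$ and $\mathbf{1}_{p}$ is the all-ones vector of length $p$; let $t_i\in\mathbb{R}^d$ be column $n+i$ of $H$. For a perfect alignment $S$, $S_i^Tx_{k,i}+t_i=S_j^Tx_{k,j}+t_j$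 whenever $(k,i),(k,j)\in E(\Gamma)$. For disjoint non-empty $A,B\subseteq\{1,\dots,m\}$, $B(S)_{A,B}$ is the matrix whose columns (in increasing order of $k$) are $S_i^Tx_{k,i}+t_i$, over those $k$ for which $(k,i),(k,j)\in E(\Gamma)$ for some $i\in A$ and $j\in B$ (one column per such $k$). With $n'$ its number of columns, $\overline{B(S)}_{A,B}=B(S)_{A,B}(I_{n'}-(1/n')\mathbf{1}_{n'}\mathbf{1}_{n'}^T)$. *)

theory Defs
  imports "HOL-Analysis.Analysis"
begin

(* Points, views and coordinates are indexed by finite types 'n, 'm and 'd, so that
   n = CARD('n), m = CARD('m), d = CARD('d).  Vertices of the graph are elements of 'n + 'm
   and the rows of an (m d)-row matrix are indexed by 'm \<times> 'd.  The linear orders give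
   "the first view" and "increasing order of points". *)

section \<open>Linear algebra\<close>

definition outer :: "real^'a \<Rightarrow> real^'b \<Rightarrow> real^'b^'a" where
  "outer u v = (\<chi> r c. u $ r * v $ c)"

(* Kronecker product of a column vector with a matrix *)
definition kron :: "real^'m \<Rightarrow> real^'b^'a \<Rightarrow> real^'b^('m \<times> 'a)" where
  "kron u M = (\<chi> r c. u $ fst r * M $ snd r $ c)"

(* the Penrose conditions; they have exactly one solution *)
definition is_pinv :: "real^'b^'a \<Rightarrow> real^'a^'b \<Rightarrow> bool" where
  "is_pinv M X \<longleftrightarrow> M ** X ** M = M \<and> X ** M ** X = X \<and>
     transpose (M ** X) = M ** X \<and> transpose (X ** M) = X ** M"

definition pinv :: "real^'b^'a \<Rightarrow> real^'a^'b" where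
  "pinv M = (THE X. is_pinv M X)"

section \<open>Patch frameworks\<close>

record ('n, 'm, 'd::finite) patch_framework =
  edges :: "('n \<times> 'm) set"
  coord :: "'n \<Rightarrow> 'm \<Rightarrow> real^'d"

definition adj :: "('n::finite, 'm::finite, 'd::finite) patch_framework \<Rightarrow> (('n + 'm) \<times> ('n + 'm)) set" where
  "adj \<Theta> = {(Inl k, Inr i) | k i. (k, i) \<in> edges \<Theta>} \<union> {(Inr i, Inl k) | k i. (k, i) \<in> edges \<Theta>}"

definition graph_connected :: "('n::finite, 'm::finite, 'd::finite) patch_framework \<Rightarrow> bool" where
  "graph_connected \<Theta> \<longleftrightarrow> (\<forall>u v. (u, v) \<in> (adj \<Theta>)\<^sup>*)"

definition affinely_nondegenerate ::
  "('n::finite, 'm::finite, 'd::finite) patch_framework \<Rightarrow> 'm \<Rightarrow> bool" where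
  "affinely_nondegenerate \<Theta> i \<longleftrightarrow>
     card {k. (k, i) \<in> edges \<Theta>} \<ge> CARD('d) + 1 \<and>
     aff_dim {coord \<Theta> k i | k. (k, i) \<in> edges \<Theta>} = int CARD('d)"

definition edge_vec :: "'n::finite \<Rightarrow> 'm::finite \<Rightarrow> real^('n + 'm)" where
  "edge_vec k i = axis (Inl k) 1 - axis (Inr i) 1"

definition view_embed :: "'m::finite \<Rightarrow> real^'d::finite^('m \<times> 'd)" where
  "view_embed i = kron (axis i 1) (mat 1)"

definition laplacian ::
  "('n::finite, 'm::finite, 'd::finite) patch_framework \<Rightarrow> real^('n + 'm)^('n + 'm)" where
  "laplacian \<Theta> = (\<Sum>(k, i)\<in>edges \<Theta>. outer (edge_vec k i) (edge_vec k i))"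

definition Bmat ::
  "('n::finite, 'm::finite, 'd::finite) patch_framework \<Rightarrow> real^('n + 'm)^('m \<times> 'd)" where
  "Bmat \<Theta> = (\<Sum>(k, i)\<in>edges \<Theta>. outer (view_embed i *v coord \<Theta> k i) (edge_vec k i))"

definition Dmat ::
  "('n::finite, 'm::finite, 'd::finite) patch_framework \<Rightarrow> real^('m \<times> 'd)^('m \<times> 'd)" where
  "Dmat \<Theta> = (\<Sum>(k, i)\<in>edges \<Theta>.
     view_embed i ** outer (coord \<Theta> k i) (coord \<Theta> k i) ** transpose (view_embed i))"

definition Cmat ::
  "('n::finite, 'm::finite, 'd::finite) patch_framework \<Rightarrow> real^('m \<times> 'd)^('m \<times> 'd)" where
  "Cmat \<Theta> = Dmat \<Theta> - Bmat \<Theta> ** pinv (laplacian \<Theta>) ** transpose (Bmat \<Theta>)"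

section \<open>Alignments\<close>

(* the vertical stack of the d x d blocks S $ i *)
definition stack :: "real^'d^'d^'m \<Rightarrow> real^'d^('m \<times> 'd)" where
  "stack S = (\<chi> r. S $ fst r $ snd r)"

definition alignment :: "real^'d^'d^'m \<Rightarrow> bool" where
  "alignment S \<longleftrightarrow> (\<forall>i. orthogonal_matrix (S $ i))"

definition objective ::
  "('n::finite, 'm::finite, 'd::finite) patch_framework \<Rightarrow> real^'d^'d^'m \<Rightarrow> real" where
  "objective \<Theta> S = trace (Cmat \<Theta> ** stack S ** transpose (stack S))"

definition perfect_alignment ::
  "('n::finite, 'm::finite, 'd::finite) patch_framework \<Rightarrow> real^'d^'d^'m \<Rightarrow> bool" where
  "perfect_alignment \<Theta> S \<longleftrightarrow> alignment S \<and> objective \<Theta> S = 0"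

section \<open>Riemannian gradient and Hessian\<close>

(* M is an embedded submanifold of a Euclidean space with the induced metric, and f is
   a smooth function on a neighbourhood of M. *)

definition tangent_space :: "'a::euclidean_space set \<Rightarrow> 'a \<Rightarrow> 'a set" where
  "tangent_space M p =
     {v. \<exists>\<gamma>::real \<Rightarrow> 'a. range \<gamma> \<subseteq> M \<and> \<gamma> 0 = p \<and> (\<gamma> has_vector_derivative v) (at 0)}"

definition orth_proj :: "'a::euclidean_space set \<Rightarrow> 'a \<Rightarrow> 'a" where
  "orth_proj T x = (THE y. y \<in> T \<and> (\<forall>v\<in>T. inner (x - y) v = 0))"

definition riem_grad :: "'a::euclidean_space set \<Rightarrow> ('a \<Rightarrow> real) \<Rightarrow> 'a \<Rightarrow> 'a" where
  "riem_grad M f p =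
     (THE g. g \<in> tangent_space M p \<and>
        (\<forall>v\<in>tangent_space M p. frechet_derivative f (at p) v = inner g v))"

(* The covariant derivative of the gradient field along v: the Levi-Civita connection of the
   induced metric is the tangential part of the derivative in the ambient space.  The derivative
   within M is determined on the tangent vectors at p, which is where it is used. *)
definition riem_hess :: "'a::euclidean_space set \<Rightarrow> ('a \<Rightarrow> real) \<Rightarrow> 'a \<Rightarrow> 'a \<Rightarrow> 'a" where
  "riem_hess M f p v =
     orth_proj (tangent_space M p) (frechet_derivative (riem_grad M f) (at p within M) v)"

definition hess_nonsingular :: "'a::euclidean_space set \<Rightarrow> ('a \<Rightarrow> real) \<Rightarrow> 'a \<Rightarrow> bool" where
  "hess_nonsingular M f p \<longleftrightarrow> (\<forall>v\<in>tangent_space M p. riem_hess M f p v = 0 \<longrightarrow> v = 0)"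

definition local_minimizer :: "'a::metric_space set \<Rightarrow> ('a \<Rightarrow> real) \<Rightarrow> 'a \<Rightarrow> bool" where
  "local_minimizer M f p \<longleftrightarrow> p \<in> M \<and> (\<exists>\<epsilon>>0. \<forall>q\<in>M. dist q p < \<epsilon> \<longrightarrow> f p \<le> f q)"

section \<open>Non-degenerate alignments\<close>

definition first_view :: "'m::{finite,linorder}" where
  "first_view = Min UNIV"

(* An (m-1)-tuple of d x d matrices is indexed by the views other than the first one; it is
   represented with a zero block at the first view.  This also covers m = 1. *)
definition reduced_alignments :: "(real^'d^'d^'m::{finite,linorder}) set" where
  "reduced_alignments =
     {T. T $ first_view = 0 \<and> (\<forall>i. i \<noteq> first_view \<longrightarrow> orthogonal_matrix (T $ i))}"

definition quotient_map :: "real^'d^'d^'m::{finite,linorder} \<Rightarrow> real^'d^'d^'m::{finite,linorder}" where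
  "quotient_map S = (\<chi> i. if i = first_view then 0 else S $ i ** transpose (S $ first_view))"

definition reduced_objective ::
  "('n::finite, 'm::{finite,linorder}, 'd::finite) patch_framework \<Rightarrow> real^'d^'d^'m::{finite,linorder} \<Rightarrow> real" where
  "reduced_objective \<Theta> T = objective \<Theta> (\<chi> i. if i = first_view then mat 1 else T $ i)"

definition nondegenerate ::
  "('n::finite, 'm::{finite,linorder}, 'd::finite) patch_framework \<Rightarrow> real^'d^'d^'m::{finite,linorder} \<Rightarrow> bool" where
  "nondegenerate \<Theta> S \<longleftrightarrow>
     local_minimizer reduced_alignments (reduced_objective \<Theta>) (quotient_map S) \<and>
     hess_nonsingular reduced_alignments (reduced_objective \<Theta>) (quotient_map S)"

section \<open>Overlaps\<close>

definition point_indicator :: "real^('n::finite + 'm::finite)" where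
  "point_indicator = (\<chi> v. case v of Inl k \<Rightarrow> 1 | Inr i \<Rightarrow> 0)"

definition Hmat ::
  "('n::finite, 'm::finite, 'd::finite) patch_framework \<Rightarrow> real^'d^'d^'m \<Rightarrow> real^('n + 'm)^'d" where
  "Hmat \<Theta> S = transpose (stack S) ** Bmat \<Theta> ** pinv (laplacian \<Theta>) **
     (mat 1 - (1 / real CARD('n)) *\<^sub>R outer point_indicator 1)"

definition translation ::
  "('n::finite, 'm::finite, 'd::finite) patch_framework \<Rightarrow> real^'d^'d^'m \<Rightarrow> 'm \<Rightarrow> real^'d" where
  "translation \<Theta> S i = column (Inr i) (Hmat \<Theta> S)"

definition overlap ::
  "('n::finite, 'm::finite, 'd::finite) patch_framework \<Rightarrow> 'm set \<Rightarrow> 'm set \<Rightarrow> 'n set" where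
  "overlap \<Theta> A B = {k. (\<exists>i\<in>A. (k, i) \<in> edges \<Theta>) \<and> (\<exists>j\<in>B. (k, j) \<in> edges \<Theta>)}"

(* A matrix with d rows and n' columns is represented by the list of its n' columns, since n'
   depends on the sets A and B.  For a perfect alignment the column of a point k
   does not depend on the view i that is chosen. *)
definition overlap_matrix ::
  "('n::{finite,linorder}, 'm::finite, 'd::finite) patch_framework \<Rightarrow> real^'d^'d^'m \<Rightarrow>
     'm set \<Rightarrow> 'm set \<Rightarrow> (real^'d) list" where
  "overlap_matrix \<Theta> S A B =
     map (\<lambda>k. let i = (SOME i. i \<in> A \<and> (k, i) \<in> edges \<Theta>)
              in transpose (S $ i) *v coord \<Theta> k i + translation \<Theta> S i)
       (sorted_list_of_set (overlap \<Theta> A B))"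

(* the columns of X (I - (1/n') 1 1^T) *)
definition centred :: "(real^'d) list \<Rightarrow> (real^'d) list" where
  "centred X = (let n' = length X in
     map (\<lambda>j. \<Sum>l<n'. ((if l = j then 1 else 0) - 1 / real n') *\<^sub>R (X ! l)) [0..<n'])"

(* as for the function rank of HOL-Analysis: the dimension of the column space *)
definition list_rank :: "(real^'d) list \<Rightarrow> nat" where
  "list_rank X = dim (set X)"

end

theory Submission
  imports Defs
begin

text \<open>The objective \<open>F(S)\<close> is the minimum over placements \<open>Z\<close> of the points and views of the
least-squares error \<open>\<Sum> |S\<^sub>i\<^sup>T x\<^sub>k\<^sub>i - Z e\<^sub>k\<^sub>i|\<^sup>2\<close>; hence it is nonnegative on all matrix tuples, and it
vanishes exactly when some placement realises every local view. If the centred overlap of \<open>A\<close> and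
\<open>B\<close> has rank at most \<open>d - 2\<close>, some nonzero skew matrix \<open>K\<close> kills it. Rotating the views of the side
that avoids the first view along a curve with velocity \<open>K\<close> about the centroid of the overlap fixes
the overlap, so all alignments on the resulting curve are perfect. They minimise the reduced
objective even on the ambient space, so the Riemannian gradient vanishes along the curve, and the
Hessian is zero on its nonzero velocity.\<close>

section \<open>Matrix algebra\<close>

declare transpose_matrix_vector [simp del]

lemma bounded_bilinear_matrix_mult:
  "bounded_bilinear ((**) :: real^'b^'a \<Rightarrow> real^'c^'b \<Rightarrow> real^'c^'a)"
  unfolding bilinear_conv_bounded_bilinear[symmetric] bilinear_def linear_iff
  by (auto simp: vec_eq_iff matrix_matrix_mult_def sum.distrib algebra_simps sum_distrib_left)

interpretation matmul: bounded_bilinear "(**) :: real^'b^'a \<Rightarrow> real^'c^'b \<Rightarrow> real^'c^'a"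
  by (rule bounded_bilinear_matrix_mult)

lemma linear_transpose: "linear (transpose :: real^'b^'a \<Rightarrow> real^'a^'b)"
  unfolding linear_iff
  by (auto simp: vec_eq_iff transpose_def)

lemmas transpose_add = linear_add[OF linear_transpose]
  and transpose_diff = linear_diff[OF linear_transpose]
  and transpose_sum = linear_sum[OF linear_transpose]
  and transpose_zero = linear_0[OF linear_transpose]

lemma bounded_bilinear_outer: "bounded_bilinear (outer :: real^'a \<Rightarrow> real^'b \<Rightarrow> real^'b^'a)"
  unfolding bilinear_conv_bounded_bilinear[symmetric] bilinear_def linear_iff
  by (auto simp: vec_eq_iff outer_def algebra_simps)

interpretation outer: bounded_bilinear "outer :: real^'a \<Rightarrow> real^'b \<Rightarrow> real^'b^'a"
  by (rule bounded_bilinear_outer)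

lemma bounded_bilinear_matrix_vector_mult:
  "bounded_bilinear ((*v) :: real^'b^'a \<Rightarrow> real^'b \<Rightarrow> real^'a)"
  unfolding bilinear_conv_bounded_bilinear[symmetric] bilinear_def linear_iff
  by (auto simp: vec_eq_iff matrix_vector_mult_def sum.distrib algebra_simps sum_distrib_left)

interpretation matvec: bounded_bilinear "(*v) :: real^'b^'a \<Rightarrow> real^'b \<Rightarrow> real^'a"
  by (rule bounded_bilinear_matrix_vector_mult)

lemma linear_trace: "linear (trace :: real^'a^'a \<Rightarrow> real)"
  unfolding linear_iff
  by (auto simp: trace_def sum.distrib sum_distrib_left)

lemmas trace_sum = linear_sum[OF linear_trace]

lemma trace_outer: "trace (outer u v) = u \<bullet> v"
  by (simp add: trace_def outer_def inner_vec_def)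

lemma transpose_outer: "transpose (outer u v) = outer v u"
  by (simp add: outer_def transpose_def vec_eq_iff)

lemma matrix_mul_outer: "A ** outer u v = outer (A *v u) v"
  by (simp add: outer_def matrix_matrix_mult_def matrix_vector_mult_def vec_eq_iff
      sum_distrib_right mult.assoc)

lemma outer_mul_matrix: "outer u v ** A = outer u (transpose A *v v)"
  by (simp add: outer_def matrix_matrix_mult_def matrix_vector_mult_def vec_eq_iff transpose_def
      sum_distrib_left ac_simps)

lemma outer_mul_vector: "outer u v *v x = (v \<bullet> x) *\<^sub>R u"
  by (simp add: outer_def matrix_vector_mult_def vec_eq_iff inner_vec_def
      sum_distrib_left sum_distrib_right ac_simps)

lemma inner_mul_vector: "x \<bullet> (A *v y) = (transpose A *v x) \<bullet> y" for A :: "real^'b^'a"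
  by (metis dot_lmul_matrix transpose_transpose vector_transpose_matrix)

text \<open>The product of the projections \<open>M ** X\<close> and \<open>M ** Y\<close> is
  \<open>M ** Y\<close>. Both are symmetric, so transposing reverses the factors and yields
  \<open>M ** X\<close>; hence they agree. Likewise \<open>X ** M = Y ** M\<close>, and then
  \<open>X = X ** M ** X = Y ** M ** Y = Y\<close>.\<close>

lemma is_pinv_unique:
  assumes X: "is_pinv M X" and Y: "is_pinv M Y"
  shows "X = Y"
proof -
  have "X ** M = Y ** M"
    using X Y unfolding is_pinv_def by (metis matrix_transpose_mul matrix_mul_assoc)
  moreover have "M ** X = M ** Y"
    using X Y unfolding is_pinv_def by (metis matrix_transpose_mul matrix_mul_assoc)
  ultimately show ?thesis
    using X Y unfolding is_pinv_def by (metis matrix_mul_assoc)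
qed

lemma pinv_eqI: "is_pinv M X \<Longrightarrow> pinv M = X"
  unfolding pinv_def using is_pinv_unique by blast

section \<open>The pseudoinverse of the Laplacian\<close>

lemma edge_vec_inner_one: "edge_vec k i \<bullet> 1 = 0"
  by (simp add: edge_vec_def inner_diff_left inner_axis')

lemma laplacian_mul_vector:
  "laplacian \<Theta> *v z = (\<Sum>(k, i)\<in>edges \<Theta>. (edge_vec k i \<bullet> z) *\<^sub>R edge_vec k i)"
  by (simp add: laplacian_def matvec.sum_left case_prod_unfold outer_mul_vector)

lemma transpose_laplacian: "transpose (laplacian \<Theta>) = laplacian \<Theta>"
  by (simp add: laplacian_def transpose_sum case_prod_unfold transpose_outer)

text \<open>An edge vector is orthogonal to \<open>z\<close> exactly when \<open>z\<close> agrees at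
  both ends of the edge, and equality propagates along paths. This confines the kernel of the
  Laplacian to the constant vectors.\<close>

lemma graph_connected_const:
  fixes z :: "real^('n::finite + 'm::finite)"
  assumes "graph_connected (\<Theta> :: ('n, 'm, 'd::finite) patch_framework)"
    and "\<And>k i. (k, i) \<in> edges \<Theta> \<Longrightarrow> edge_vec k i \<bullet> z = 0"
  shows "z $ u = z $ v"
proof -
  have step: "z $ u = z $ v" if "(u, v) \<in> adj \<Theta>" for u v
    using that assms(2) by (auto simp: adj_def edge_vec_def inner_diff_left inner_axis')
  have "(u, v) \<in> (adj \<Theta>)\<^sup>*" using assms(1) by (simp add: graph_connected_def)
  then show ?thesis by (induction) (auto dest: step)
qed

text \<open>The orthogonal projection onto the constant vectors.\<close>

definition mean_proj :: "real^'a^'a" where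
  "mean_proj = (1 / real CARD('a)) *\<^sub>R outer 1 1"

lemma mean_proj_idem: "(mean_proj :: real^'a^'a) ** mean_proj = mean_proj"
  by (simp add: mean_proj_def matmul.scaleR_left matmul.scaleR_right matrix_mul_outer outer_mul_vector
      outer.scaleR_left matvec.scaleR_left inner_vec_def)

text \<open>The pseudoinverse is \<open>(L + J)\<^sup>-\<^sup>1 - J\<close> with \<open>J\<close> = \<open>mean_proj\<close>; connectedness makes \<open>L + J\<close> invertible.\<close>

lemma pinv_laplacian:
  fixes \<Theta> :: "('n::finite, 'm::finite, 'd::finite) patch_framework"
  assumes conn: "graph_connected \<Theta>"
  shows "pinv (laplacian \<Theta>) ** laplacian \<Theta> = mat 1 - mean_proj"
    and "laplacian \<Theta> ** pinv (laplacian \<Theta>) = mat 1 - mean_proj"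
    and "transpose (pinv (laplacian \<Theta>)) = pinv (laplacian \<Theta>)"
proof -
  define L where "L = laplacian \<Theta>"
  define J where "J = (mean_proj :: real^('n + 'm)^('n + 'm))"
  define M where "M = L + J"
  have JJ: "J ** J = J" unfolding J_def by (rule mean_proj_idem)
  have Jt: "transpose J = J" by (simp add: J_def mean_proj_def transpose_scalar transpose_outer)
  have Lt: "transpose L = L" unfolding L_def by (rule transpose_laplacian)
  have "L *v 1 = 0" unfolding L_def
    by (simp add: laplacian_mul_vector edge_vec_inner_one case_prod_unfold)
  then have LJ: "L ** J = 0"
    by (simp add: J_def mean_proj_def matmul.scaleR_right matrix_mul_outer outer.zero_left)
  then have JL: "J ** L = 0"
    by (metis Jt Lt matrix_transpose_mul transpose_zero)
  \<comment> \<open>The quadratic form of \<open>M\<close> is a sum of squares. The edge terms force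
    \<open>z\<close> to be constant, and the term from \<open>J\<close> forces its entries to sum to
    zero.\<close>
  have "z = 0" if z: "M *v z = 0" for z
  proof -
    have "0 = z \<bullet> (M *v z)" using z by simp
    also have "\<dots> = (\<Sum>(k, i)\<in>edges \<Theta>. (edge_vec k i \<bullet> z)\<^sup>2) + (1 \<bullet> z)\<^sup>2 / real CARD('n + 'm)"
      by (simp add: M_def L_def J_def mean_proj_def matvec.add_left laplacian_mul_vector inner_add_right
          inner_sum_right case_prod_unfold matvec.scaleR_left outer_mul_vector power2_eq_square
          inner_commute)
    finally have sum0: "(\<Sum>(k, i)\<in>edges \<Theta>. (edge_vec k i \<bullet> z)\<^sup>2) + (1 \<bullet> z)\<^sup>2 / real CARD('n + 'm) = 0"
      by simp
    have nn: "(\<Sum>(k, i)\<in>edges \<Theta>. (edge_vec k i \<bullet> z)\<^sup>2) \<ge> 0"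
      by (rule sum_nonneg) auto
    have nn2: "(1 \<bullet> z)\<^sup>2 / real CARD('n + 'm) \<ge> 0" by simp
    have A: "(\<Sum>(k, i)\<in>edges \<Theta>. (edge_vec k i \<bullet> z)\<^sup>2) = 0" and B: "(1 \<bullet> z)\<^sup>2 / real CARD('n + 'm) = 0"
      using sum0 nn nn2 by linarith+
    have e0: "edge_vec k i \<bullet> z = 0" if "(k, i) \<in> edges \<Theta>" for k i
      using A that by (subst (asm) sum_nonneg_eq_0_iff) auto
    have c: "z $ u = z $ v" for u v
      using graph_connected_const[OF conn e0] by blast
    have card: "real CARD('n + 'm) \<noteq> 0" by (metis of_nat_eq_0_iff zero_less_card_finite less_numeral_extra(3))
    have "1 \<bullet> z = 0" using B card by (metis divide_eq_0_iff zero_eq_power2)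
    then have "(\<Sum>u\<in>UNIV. z $ u) = 0" by (simp add: inner_vec_def)
    moreover have "(\<Sum>u\<in>UNIV. z $ u) = (\<Sum>u::'n + 'm\<in>UNIV. z $ v)" for v
      by (rule sum.cong[OF refl c])
    ultimately have "(\<Sum>u::'n + 'm\<in>UNIV. z $ v) = 0" for v
      by metis
    then have "z $ v = 0" for v
      using card by (metis mult_eq_0_iff sum_constant)
    then show ?thesis by (simp add: vec_eq_iff)
  qed
  then obtain N where NM: "N ** M = mat 1"
    using matrix_left_invertible_ker[of M] by auto
  then have MN: "M ** N = mat 1" by (simp add: matrix_left_right_inverse)
  have Mt: "transpose M = M" by (simp add: M_def transpose_add Lt Jt)
  have Nt: "transpose N = N"
    by (metis MN Mt NM matrix_mul_assoc matrix_mul_lid matrix_mul_rid matrix_transpose_mul transpose_mat)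
  \<comment> \<open>\<open>M\<close> acts as the identity on the range of \<open>J\<close>, hence so
    does its inverse \<open>N\<close>. Thus \<open>N - J\<close> vanishes on the constants and still
    inverts \<open>L\<close> on their orthogonal complement.\<close>
  have MJ: "M ** J = J" by (simp add: M_def matmul.add_left LJ JJ)
  have JM: "J ** M = J" by (simp add: M_def matmul.add_right JL JJ)
  have NJ: "N ** J = J" by (metis MJ NM matrix_mul_assoc matrix_mul_lid)
  have JN: "J ** N = J" by (metis JM MN matrix_mul_assoc matrix_mul_rid)
  have L: "L = M - J" by (simp add: M_def)
  have LX: "L ** (N - J) = mat 1 - J"
    by (simp add: L matmul.diff_left matmul.diff_right MN MJ JN JJ)
  have XL: "(N - J) ** L = mat 1 - J"
    by (simp add: L matmul.diff_left matmul.diff_right NM JM NJ JJ)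
  have "is_pinv L (N - J)"
    unfolding is_pinv_def LX XL
    by (simp add: matmul.diff_left matmul.diff_right JL JN JJ transpose_diff Jt)
  then have X: "pinv L = N - J" by (rule pinv_eqI)
  show "pinv (laplacian \<Theta>) ** laplacian \<Theta> = mat 1 - mean_proj"
    and "laplacian \<Theta> ** pinv (laplacian \<Theta>) = mat 1 - mean_proj"
    and "transpose (pinv (laplacian \<Theta>)) = pinv (laplacian \<Theta>)"
    using X XL LX Nt Jt by (auto simp: L_def J_def transpose_diff)
qed

section \<open>The objective as a least-squares error\<close>

lemma mean_proj_mul_edge_vec: "mean_proj *v edge_vec k i = 0"
  by (simp add: mean_proj_def matvec.scaleR_left outer_mul_vector inner_commute[of 1] edge_vec_inner_one)

lemma transpose_mean_proj: "transpose mean_proj = mean_proj"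
  by (simp add: mean_proj_def transpose_scalar transpose_outer)

text \<open>Column \<open>Inl k\<close> of \<open>Z\<close> places a point and column
  \<open>Inr i\<close> is the translation of a view, so this is the gap between the transformed
  local coordinates and the placed point.\<close>

abbreviation residual ::
  "('n::finite, 'm::finite, 'd::finite) patch_framework \<Rightarrow> real^'d^'d^'m \<Rightarrow> real^('n + 'm)^'d \<Rightarrow> 'n \<Rightarrow> 'm \<Rightarrow> real^'d"
  where "residual \<Theta> S Z k i \<equiv> transpose (S $ i) *v coord \<Theta> k i - Z *v edge_vec k i"

lemma kron_mul_vector: "(kron u M *v x) $ r = u $ fst r * (M *v x) $ snd r"
  by (simp add: kron_def matrix_vector_mult_def sum_distrib_left mult.assoc)

lemma transpose_stack_mul_view_embed:
  "transpose (stack S) *v (view_embed i *v x) = transpose (S $ i) *v x"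
proof -
  have eq: "view_embed i *v x = (\<chi> r. if fst r = i then x $ snd r else 0)"
    by (simp add: vec_eq_iff view_embed_def kron_mul_vector axis_def)
  have "(\<Sum>r\<in>UNIV. S $ fst r $ snd r $ c * (if fst r = i then x $ snd r else 0)) =
      (\<Sum>b\<in>UNIV. S $ i $ b $ c * x $ b)" for c
  proof -
    have "(\<Sum>r\<in>UNIV. S $ fst r $ snd r $ c * (if fst r = i then x $ snd r else 0)) =
        (\<Sum>a\<in>UNIV. \<Sum>b\<in>UNIV. S $ a $ b $ c * (if a = i then x $ b else 0))"
      by (simp add: sum.cartesian_product case_prod_unfold)
    also have "\<dots> = (\<Sum>a\<in>UNIV. if a = i then \<Sum>b\<in>UNIV. S $ i $ b $ c * x $ b else 0)"
      by (intro sum.cong) auto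
    finally show ?thesis by simp
  qed
  then show ?thesis unfolding eq
    by (simp add: vec_eq_iff matrix_vector_mult_def transpose_def stack_def)
qed

lemma transpose_stack_mul_Bmat:
  "transpose (stack S) ** Bmat \<Theta> =
     (\<Sum>(k, i)\<in>edges \<Theta>. outer (transpose (S $ i) *v coord \<Theta> k i) (edge_vec k i))"
  by (simp add: Bmat_def matmul.sum_right case_prod_unfold matrix_mul_outer
      transpose_stack_mul_view_embed)

text \<open>The four terms come from expanding the outer product for an arbitrary placement
  \<open>Z\<close>. Taking the trace turns the left side into the least-squares error.\<close>

lemma sum_outer_residual:
  fixes \<Theta> :: "('n::finite, 'm::finite, 'd::finite) patch_framework"
  shows "(\<Sum>(k, i)\<in>edges \<Theta>. outer (residual \<Theta> S Z k i) (residual \<Theta> S Z k i)) =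
    transpose (stack S) ** Dmat \<Theta> ** stack S
    - transpose (stack S) ** Bmat \<Theta> ** transpose Z
    - Z ** transpose (transpose (stack S) ** Bmat \<Theta>)
    + Z ** laplacian \<Theta> ** transpose Z"
  unfolding transpose_stack_mul_Bmat
  by (simp add: Dmat_def laplacian_def matmul.sum_right matmul.sum_left transpose_sum case_prod_unfold
      matrix_mul_outer outer_mul_matrix transpose_outer transpose_stack_mul_view_embed
      outer.diff_left outer.diff_right sum_subtractf sum.distrib algebra_simps)

text \<open>For a connected graph this solves the normal equations \<open>Z ** laplacian \<Theta> =
  transpose (stack S) ** Bmat \<Theta>\<close> of the least-squares problem in
  \<open>Z\<close>.\<close>

definition opt_placement ::
  "('n::finite, 'm::finite, 'd::finite) patch_framework \<Rightarrow> real^'d^'d^'m \<Rightarrow> real^('n + 'm)^'d" where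
  "opt_placement \<Theta> S = transpose (stack S) ** Bmat \<Theta> ** pinv (laplacian \<Theta>)"

text \<open>By the normal equations the quadratic term in \<open>Z\<close> cancels one of the two
  mixed terms. The other one equals \<open>Y ** X ** transpose Y\<close>, which is the part that
  \<open>Cmat\<close> subtracts from \<open>Dmat\<close>.\<close>

lemma objective_eq_sum_residual:
  fixes \<Theta> :: "('n::finite, 'm::finite, 'd::finite) patch_framework"
  assumes conn: "graph_connected \<Theta>"
  shows "objective \<Theta> S = (\<Sum>(k, i)\<in>edges \<Theta>. (norm (residual \<Theta> S (opt_placement \<Theta> S) k i))\<^sup>2)"
proof -
  define Y where "Y = transpose (stack S) ** Bmat \<Theta>"
  define X where "X = pinv (laplacian \<Theta>)"
  have Xt: "transpose X = X" using pinv_laplacian(3)[OF conn] by (simp add: X_def)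
  have Z: "opt_placement \<Theta> S = Y ** X" by (simp add: opt_placement_def Y_def X_def)
  \<comment> \<open>The rows of \<open>Y\<close> are combinations of edge vectors, which are
    orthogonal to the constants; there \<open>X ** laplacian \<Theta>\<close> acts as the
    identity.\<close>
  have "Y ** mean_proj = 0"
    by (simp add: Y_def transpose_stack_mul_Bmat matmul.sum_left outer_mul_matrix case_prod_unfold
        transpose_mean_proj mean_proj_mul_edge_vec outer.zero_right)
  then have ZL: "(Y ** X) ** laplacian \<Theta> = Y"
    by (simp add: matrix_mul_assoc[symmetric] X_def pinv_laplacian(1)[OF conn] matmul.diff_right)
  have "(\<Sum>(k, i)\<in>edges \<Theta>. (norm (residual \<Theta> S (Y ** X) k i))\<^sup>2) =
      trace (\<Sum>(k, i)\<in>edges \<Theta>. outer (residual \<Theta> S (Y ** X) k i) (residual \<Theta> S (Y ** X) k i))"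
    by (simp add: trace_sum case_prod_unfold trace_outer power2_norm_eq_inner)
  also have "\<dots> = trace (transpose (stack S) ** Dmat \<Theta> ** stack S - Y ** X ** transpose Y)"
    unfolding sum_outer_residual
    by (simp add: Y_def[symmetric] ZL matrix_transpose_mul[of Y X] Xt matrix_mul_assoc)
  also have "\<dots> = trace (transpose (stack S) ** Cmat \<Theta> ** stack S)"
    by (simp add: Cmat_def Y_def X_def matmul.diff_left matmul.diff_right matrix_mul_assoc
        matrix_transpose_mul)
  also have "\<dots> = objective \<Theta> S"
    unfolding objective_def by (subst trace_mul_sym[of "Cmat \<Theta> ** stack S"]) (simp add: matrix_mul_assoc)
  finally show ?thesis by (simp add: Z)
qed

text \<open>Here \<open>S\<close> is any tuple of matrices, orthogonal or not, so zeros of the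
  objective are minimisers in the whole ambient space.\<close>

lemma objective_nonneg: "graph_connected \<Theta> \<Longrightarrow> objective \<Theta> S \<ge> 0"
  unfolding objective_eq_sum_residual by (auto intro!: sum_nonneg)

lemma objective_eq_0_imp:
  assumes "graph_connected \<Theta>" "objective \<Theta> S = 0" "(k, i) \<in> edges \<Theta>"
  shows "transpose (S $ i) *v coord \<Theta> k i = opt_placement \<Theta> S *v edge_vec k i"
  using assms(2,3) unfolding objective_eq_sum_residual[OF assms(1)]
  by (subst (asm) sum_nonneg_eq_0_iff) auto

text \<open>An exact placement \<open>Z\<close> satisfies the normal equations, so the optimal
  placement differs from it only by a common translation of all columns, which edge vectors do not
  see.\<close>

lemma objective_eq_0I:
  fixes \<Theta> :: "('n::finite, 'm::finite, 'd::finite) patch_framework"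
  assumes conn: "graph_connected \<Theta>"
    and Z: "\<And>k i. (k, i) \<in> edges \<Theta> \<Longrightarrow> transpose (S $ i) *v coord \<Theta> k i = Z *v edge_vec k i"
  shows "objective \<Theta> S = 0"
proof -
  have "transpose (stack S) ** Bmat \<Theta> = Z ** laplacian \<Theta>"
    using Z by (auto simp add: transpose_stack_mul_Bmat laplacian_def matmul.sum_right matrix_mul_outer
        case_prod_unfold intro!: sum.cong)
  then have "opt_placement \<Theta> S = Z ** (mat 1 - mean_proj)"
    by (simp add: opt_placement_def matrix_mul_assoc[symmetric] pinv_laplacian(2)[OF conn])
  then have "opt_placement \<Theta> S *v edge_vec k i = Z *v edge_vec k i" for k i
    by (simp add: matrix_vector_mul_assoc[symmetric] matvec.diff_left mean_proj_mul_edge_vec)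
  then show ?thesis
    unfolding objective_eq_sum_residual[OF conn] using Z by (auto intro!: sum.neutral)
qed

section \<open>The manifold of reduced alignments\<close>

lemma inner_matrix_eq_trace: "A \<bullet> B = trace (A ** transpose B)" for A B :: "real^'b^'a"
  by (simp add: inner_vec_def trace_def matrix_matrix_mult_def transpose_def)

lemma transpose_skew_inner_zero:
  fixes K :: "real^'d^'d"
  assumes "transpose K = - K"
  shows "x \<bullet> (K *v x) = 0"
proof -
  have "x \<bullet> (K *v x) = - (x \<bullet> (K *v x))"
    using inner_mul_vector[of x K x] assms by (simp add: matvec.minus_left inner_commute)
  then show ?thesis by simp
qed

text \<open>With a second-order remainder bound the Cayley curve can be differentiated without
  differentiating a matrix inverse.\<close>

lemma has_vector_derivative_quadratic_bound:
  fixes R :: "real \<Rightarrow> 'a::real_normed_vector"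
  assumes "\<And>t. norm (R t - R 0 - t *\<^sub>R K) \<le> C * t\<^sup>2"
  shows "(R has_vector_derivative K) (at 0)"
  unfolding has_vector_derivative_def
proof (rule has_derivativeI_sandwich[of 1])
  show "bounded_linear (\<lambda>t. t *\<^sub>R K)" by (rule bounded_linear_scaleR_left)
  show "norm (R t - R 0 - (t - 0) *\<^sub>R K) / norm (t - 0) \<le> C * \<bar>t\<bar>" if "t \<noteq> 0" for t
    using assms[of t] that by (simp add: divide_le_eq power2_eq_square mult.assoc)
  have "((\<lambda>t. C * \<bar>t\<bar>) \<longlongrightarrow> C * \<bar>0\<bar>) (at 0)" by (intro tendsto_intros)
  then show "((\<lambda>t. C * \<bar>t\<bar>) \<longlongrightarrow> 0) (at 0)" by simp
qed simp

text \<open>The curve is the Cayley transform of \<open>t K / 2\<close>.\<close>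

lemma rotation_curve:
  fixes K :: "real^'d^'d"
  assumes skew: "transpose K = - K"
  obtains R :: "real \<Rightarrow> real^'d^'d" where
    "\<And>t. orthogonal_matrix (R t)" "R 0 = mat 1" "(R has_vector_derivative K) (at 0)"
    "\<And>t x. K *v x = 0 \<Longrightarrow> R t *v x = x"
proof -
  \<comment> \<open>The Cayley curve of \<open>H\<close> has velocity \<open>2 * H\<close> at 0,
    hence the factor one half.\<close>
  define H where "H = (1 / 2) *\<^sub>R K"
  have Ht: "transpose H = - H" by (simp add: H_def transpose_scalar skew)
  \<comment> \<open>Invertibility holds for every \<open>t\<close>, not only for small ones, since
    \<open>x\<close> is orthogonal to \<open>H *v x\<close>. The curve is therefore defined on the
    whole line.\<close>
  have "\<exists>N. N ** (mat 1 - t *\<^sub>R H) = mat 1" for t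
    unfolding matrix_left_invertible_ker
  proof (intro allI impI)
    fix x assume "(mat 1 - t *\<^sub>R H) *v x = 0"
    then have "x = t *\<^sub>R (H *v x)" by (simp add: matvec.diff_left matvec.scaleR_left)
    then have "x \<bullet> x = t * (x \<bullet> (H *v x))" by (metis inner_scaleR_right)
    then show "x = 0" by (simp add: transpose_skew_inner_zero[OF Ht])
  qed
  then obtain N where N: "\<And>t. N t ** (mat 1 - t *\<^sub>R H) = mat 1" by metis
  define R where "R = (\<lambda>t. N t ** (mat 1 + t *\<^sub>R H))"
  have Nt: "(mat 1 + t *\<^sub>R H) ** transpose (N t) = mat 1" for t
    using arg_cong[OF N[of t], of transpose]
    by (simp add: matrix_transpose_mul transpose_diff transpose_scalar Ht)
  have "R t ** transpose (R t) = mat 1" for t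
  proof -
    have "R t ** transpose (R t) = N t ** ((mat 1 + t *\<^sub>R H) ** (mat 1 - t *\<^sub>R H)) ** transpose (N t)"
      by (simp add: R_def matrix_transpose_mul transpose_add transpose_scalar Ht matrix_mul_assoc)
    also have "(mat 1 + t *\<^sub>R H) ** (mat 1 - t *\<^sub>R H) = (mat 1 - t *\<^sub>R H) ** (mat 1 + t *\<^sub>R H)"
      by (simp add: matmul.diff_left matmul.diff_right matmul.add_left matmul.add_right algebra_simps)
    finally show ?thesis by (metis N Nt matrix_mul_assoc matrix_mul_lid)
  qed
  then have orth: "orthogonal_matrix (R t)" for t
    by (simp add: orthogonal_matrix_def matrix_left_right_inverse)
  have R0: "R 0 = mat 1" using N[of 0] by (simp add: R_def)
  \<comment> \<open>Orthogonal matrices have constant norm, so \<open>N t\<close>, which is half of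
    \<open>mat 1 + R t\<close>, is bounded uniformly in \<open>t\<close>. This bounds the remainder
    \<open>2 * t^2\<close> times \<open>N t ** (H ** H)\<close>.\<close>
  have normR: "norm (R t) = sqrt (real CARD('d))" for t
    using orth[of t]
    by (simp add: norm_eq_sqrt_inner inner_matrix_eq_trace orthogonal_matrix_def trace_I)
  obtain c where c: "c > 0" "\<And>A B. norm ((A :: real^'d^'d) ** (B :: real^'d^'d)) \<le> norm A * norm B * c"
    using matmul.pos_bounded by blast
  define C where "C = (norm (mat 1 :: real^'d^'d) + sqrt (real CARD('d))) * norm (H ** H) * c"
  have "norm (R t - R 0 - t *\<^sub>R K) \<le> C * t\<^sup>2" for t
  proof -
    have N1: "N t = mat 1 + t *\<^sub>R (N t ** H)"
      using N[of t] by (simp add: matmul.diff_right matmul.scaleR_right algebra_simps)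
    have R1: "R t = N t + t *\<^sub>R (N t ** H)"
      by (simp add: R_def matmul.add_right matmul.scaleR_right)
    have N2: "N t = (1 / 2) *\<^sub>R (mat 1 + R t)"
      using N1 R1 by (simp add: scaleR_right_distrib[symmetric] vec_eq_iff)
    have "N t ** H = H + t *\<^sub>R (N t ** (H ** H))"
      by (subst N1) (simp add: matmul.add_left matmul.scaleR_left matrix_mul_assoc)
    then have "R t - R 0 - t *\<^sub>R K = (2 * t\<^sup>2) *\<^sub>R (N t ** (H ** H))"
      using N1 R1 by (simp add: R0 H_def vec_eq_iff power2_eq_square algebra_simps)
    also have "\<dots> = t\<^sup>2 *\<^sub>R ((mat 1 + R t) ** (H ** H))"
      by (subst N2) (simp add: matmul.scaleR_left)
    also have "norm \<dots> \<le> t\<^sup>2 * (norm (mat 1 + R t) * norm (H ** H) * c)"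
      using c(2) by (simp add: mult_left_mono)
    also have "norm (mat 1 + R t) \<le> norm (mat 1 :: real^'d^'d) + sqrt (real CARD('d))"
      using norm_triangle_ineq[of "mat 1" "R t"] by (simp add: normR)
    finally show ?thesis using c(1)
      by (simp add: C_def mult.commute mult_left_mono mult_right_mono)
  qed
  then have der: "(R has_vector_derivative K) (at 0)"
    by (rule has_vector_derivative_quadratic_bound)
  have fixp: "R t *v x = x" if "K *v x = 0" for t x
  proof -
    have "H *v x = 0" using that by (simp add: H_def matvec.scaleR_left)
    then have "(mat 1 + t *\<^sub>R H) *v x = (mat 1 - t *\<^sub>R H) *v x"
      by (simp add: matvec.add_left matvec.diff_left matvec.scaleR_left)
    then show ?thesis
      by (metis N R_def matrix_vector_mul_assoc matrix_vector_mul_lid)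
  qed
  show ?thesis using that[OF orth R0 der fixp] .
qed

section \<open>Tangent spaces of the reduced alignments\<close>

lemma has_derivative_vec_lambda:
  fixes f :: "'i::finite \<Rightarrow> 'a::real_normed_vector \<Rightarrow> 'b::euclidean_space"
  assumes "\<And>i. (f i has_derivative f' i) (at x within X)"
  shows "((\<lambda>x. \<chi> i. f i x) has_derivative (\<lambda>h. \<chi> i. f' i h)) (at x within X)"
  by (subst has_derivative_componentwise_within)
     (auto simp: Basis_vec_def inner_axis intro!: has_derivative_inner_left assms)

lemma has_vector_derivative_vec_lambda:
  fixes f :: "'i::finite \<Rightarrow> real \<Rightarrow> 'b::euclidean_space"
  assumes "\<And>i. (f i has_vector_derivative f' i) (at x within X)"
  shows "((\<lambda>x. \<chi> i. f i x) has_vector_derivative (\<chi> i. f' i)) (at x within X)"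
proof -
  have "(\<lambda>h. h *\<^sub>R (\<chi> i. f' i)) = (\<lambda>h. \<chi> i. h *\<^sub>R f' i)" by (simp add: vec_eq_iff fun_eq_iff)
  then show ?thesis
    using has_derivative_vec_lambda[of f "\<lambda>i h. h *\<^sub>R f' i"] assms
    by (simp add: has_vector_derivative_def)
qed

lemma tangent_spaceI:
  "(\<And>t. \<gamma> t \<in> M) \<Longrightarrow> \<gamma> 0 = p \<Longrightarrow> (\<gamma> has_vector_derivative v) (at 0) \<Longrightarrow> v \<in> tangent_space M p"
  unfolding tangent_space_def by (auto intro!: exI[of _ \<gamma>])

text \<open>Differentiating the orthogonality constraint along a curve gives one inclusion.
  Conversely the condition says that \<open>v $ i ** transpose (q $ i)\<close> is skew, and a
  rotation curve with this velocity, multiplied by \<open>q $ i\<close>, has velocity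
  \<open>v $ i\<close>.\<close>

lemma tangent_space_reduced_alignments:
  fixes q :: "real^'d^'d^'m::{finite,linorder}"
  assumes q: "q \<in> reduced_alignments"
  shows "tangent_space reduced_alignments q =
    {v. v $ first_view = 0 \<and>
        (\<forall>i. i \<noteq> first_view \<longrightarrow> v $ i ** transpose (q $ i) + q $ i ** transpose (v $ i) = 0)}"
    (is "_ = ?T")
proof (intro equalityI subsetI)
  fix v assume "v \<in> tangent_space reduced_alignments q"
  then obtain \<gamma> :: "real \<Rightarrow> real^'d^'d^'m::{finite,linorder}" where \<gamma>: "range \<gamma> \<subseteq> reduced_alignments" "\<gamma> 0 = q"
    "(\<gamma> has_vector_derivative v) (at 0)"
    by (auto simp: tangent_space_def)
  have comp: "((\<lambda>t. \<gamma> t $ i) has_vector_derivative v $ i) (at 0)" for i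
    by (rule bounded_linear.has_vector_derivative[OF bounded_linear_vec_nth \<gamma>(3)])
  have "(\<lambda>t. \<gamma> t $ first_view) = (\<lambda>t. 0)"
    using \<gamma>(1) by (auto simp: reduced_alignments_def)
  then have "v $ first_view = 0"
    using comp[of first_view] by (metis has_vector_derivative_const vector_derivative_unique_at)
  moreover have "v $ i ** transpose (q $ i) + q $ i ** transpose (v $ i) = 0" if "i \<noteq> first_view" for i
  proof -
    have "((\<lambda>t. transpose (\<gamma> t $ i)) has_vector_derivative transpose (v $ i)) (at 0)"
      by (rule bounded_linear.has_vector_derivative[OF _ comp])
         (simp add: linear_conv_bounded_linear[symmetric] linear_transpose)
    from bounded_bilinear.has_vector_derivative[OF bounded_bilinear_matrix_mult comp[of i] this]
    have "((\<lambda>t. \<gamma> t $ i ** transpose (\<gamma> t $ i)) has_vector_derivative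
        q $ i ** transpose (v $ i) + v $ i ** transpose (q $ i)) (at 0)"
      by (simp add: \<gamma>(2))
    moreover have "(\<lambda>t. \<gamma> t $ i ** transpose (\<gamma> t $ i)) = (\<lambda>t. mat 1)"
      using \<gamma>(1) that by (auto simp: reduced_alignments_def orthogonal_matrix_def)
    ultimately have "((\<lambda>t::real. mat 1 :: real^'d^'d) has_vector_derivative
        q $ i ** transpose (v $ i) + v $ i ** transpose (q $ i)) (at 0)"
      by simp
    then have "q $ i ** transpose (v $ i) + v $ i ** transpose (q $ i) = 0"
      using has_vector_derivative_const by (rule vector_derivative_unique_at)
    then show ?thesis by (simp add: add.commute)
  qed
  ultimately show "v \<in> ?T" by simp
next
  fix v assume v: "v \<in> ?T"
  have "\<exists>R :: real \<Rightarrow> real^'d^'d. (\<forall>t. orthogonal_matrix (R t)) \<and> R 0 = mat 1 \<and>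
      (R has_vector_derivative (v $ i ** transpose (q $ i))) (at 0)" if "i \<noteq> first_view" for i
  proof -
    have "transpose (v $ i ** transpose (q $ i)) = - (v $ i ** transpose (q $ i))"
      using v that by (simp add: matrix_transpose_mul eq_neg_iff_add_eq_0 add.commute)
    then show ?thesis by (rule rotation_curve) blast
  qed
  then obtain R :: "'m \<Rightarrow> real \<Rightarrow> real^'d^'d" where
    orth: "\<And>i t. i \<noteq> first_view \<Longrightarrow> orthogonal_matrix (R i t)" and
    R0: "\<And>i. i \<noteq> first_view \<Longrightarrow> R i 0 = mat 1" and
    der: "\<And>i. i \<noteq> first_view \<Longrightarrow> (R i has_vector_derivative (v $ i ** transpose (q $ i))) (at 0)"
    by metis
  define \<gamma> where "\<gamma> = (\<lambda>t. \<chi> i. if i = first_view then 0 else R i t ** q $ i)"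
  have "\<gamma> t \<in> reduced_alignments" for t
    using q orth by (auto simp: reduced_alignments_def \<gamma>_def orthogonal_matrix_mul)
  moreover have "\<gamma> 0 = q"
    using q R0 by (simp add: \<gamma>_def vec_eq_iff[where 'b='m] reduced_alignments_def)
  moreover have "(\<gamma> has_vector_derivative v) (at 0)"
  proof -
    have "((\<lambda>t. if i = first_view then 0 else R i t ** q $ i) has_vector_derivative v $ i) (at 0)" for i
    proof (cases "i = first_view")
      case False
      have "((\<lambda>t. R i t ** q $ i) has_vector_derivative v $ i ** transpose (q $ i) ** q $ i) (at 0)"
        by (rule bounded_linear.has_vector_derivative[OF matmul.bounded_linear_left der[OF False]])
      moreover have "v $ i ** transpose (q $ i) ** q $ i = v $ i"
        using q False by (simp add: reduced_alignments_def orthogonal_matrix_def matrix_mul_assoc[symmetric])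
      ultimately show ?thesis using False by simp
    qed (use v in simp)
    then have "(\<gamma> has_vector_derivative (\<chi> i. v $ i)) (at 0)"
      unfolding \<gamma>_def by (rule has_vector_derivative_vec_lambda)
    then show ?thesis by simp
  qed
  ultimately show "v \<in> tangent_space reduced_alignments q"
    by (rule tangent_spaceI)
qed

section \<open>Riemannian gradient and Hessian\<close>

text \<open>Two representing tangent vectors \<open>g\<close> and \<open>h\<close> make
  \<open>h - g\<close> orthogonal to both of them, hence to itself. The argument uses no linear
  structure of the tangent space.\<close>

lemma riem_grad_eqI:
  assumes "g \<in> tangent_space M p"
    and "\<And>v. v \<in> tangent_space M p \<Longrightarrow> frechet_derivative f (at p) v = inner g v"
  shows "riem_grad M f p = g"
  unfolding riem_grad_def
proof (rule the_equality)
  fix h assume h: "h \<in> tangent_space M p \<and> (\<forall>v\<in>tangent_space M p. frechet_derivative f (at p) v = inner h v)"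
  have "inner (h - g) h = 0" "inner (h - g) g = 0"
    using h assms by (metis inner_diff_left diff_self)+
  then have "inner (h - g) (h - g) = 0" by (simp add: inner_diff_right)
  then show "h = g" by simp
qed (use assms in auto)

lemma zero_in_tangent_space: "p \<in> M \<Longrightarrow> 0 \<in> tangent_space M p"
  by (rule tangent_spaceI[of "\<lambda>t. p"]) auto

lemma orth_proj_zero: "0 \<in> T \<Longrightarrow> orth_proj T 0 = 0"
  unfolding orth_proj_def by (rule the_equality) (auto dest: bspec)

text \<open>Differentiability of the gradient field is needed: \<open>frechet_derivative\<close> is an arbitrary
choice at points of non-differentiability.\<close>

lemma riem_hess_eq_zero:
  fixes \<gamma> :: "real \<Rightarrow> 'a::euclidean_space"
  assumes G: "\<And>q. q \<in> M \<Longrightarrow> riem_grad M f q = G q" "G differentiable (at p)"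
    and \<gamma>: "range \<gamma> \<subseteq> M" "\<gamma> 0 = p" "(\<gamma> has_vector_derivative v) (at 0)"
    and zero: "\<And>t. G (\<gamma> t) = 0"
  shows "riem_hess M f p v = 0"
proof -
  have pM: "p \<in> M" using \<gamma>(1,2) by auto
  obtain G' where "(G has_derivative G') (at p within M)"
    using G(2) by (meson differentiable_def has_derivative_at_withinI)
  then have "(riem_grad M f has_derivative G') (at p within M)"
    by (rule has_derivative_transform[OF pM, rotated]) (simp add: G(1))
  then have "(riem_grad M f has_derivative frechet_derivative (riem_grad M f) (at p within M)) (at p within M)"
    using differentiableI frechet_derivative_works by blast
  \<comment> \<open>Whichever derivative within \<open>M\<close> was chosen, the chain rule along
    the curve applies to it; uniqueness is invoked only for functions of the real parameter.\<close>
  then have "(riem_grad M f has_derivative frechet_derivative (riem_grad M f) (at p within M)) (at (\<gamma> 0) within range \<gamma>)"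
    using \<gamma>(1,2) has_derivative_subset by blast
  from has_derivative_in_compose[OF \<gamma>(3)[unfolded has_vector_derivative_def] this]
  have "((\<lambda>t. riem_grad M f (\<gamma> t)) has_derivative
      (\<lambda>t. frechet_derivative (riem_grad M f) (at p within M) (t *\<^sub>R v))) (at 0)" .
  moreover have "(\<lambda>t. riem_grad M f (\<gamma> t)) = (\<lambda>t. 0)"
    using \<gamma>(1) zero G(1) by (simp add: fun_eq_iff range_subsetD)
  ultimately have "(\<lambda>t. frechet_derivative (riem_grad M f) (at p within M) (t *\<^sub>R v)) = (\<lambda>t. 0)"
    using has_derivative_const has_derivative_unique by metis
  then have "frechet_derivative (riem_grad M f) (at p within M) v = 0"
    by (metis scaleR_one)
  then show ?thesis
    by (simp add: riem_hess_def orth_proj_zero zero_in_tangent_space[OF pM])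
qed

text \<open>The orthogonal projection of \<open>g\<close> onto the tangent space at \<open>q\<close>.\<close>

definition tangent_part :: "real^'d^'d^'m::{finite,linorder} \<Rightarrow> real^'d^'d^'m::{finite,linorder} \<Rightarrow> real^'d^'d^'m::{finite,linorder}" where
  "tangent_part q g = (\<chi> i. if i = first_view then 0
     else (1 / 2) *\<^sub>R (g $ i - q $ i ** transpose (g $ i) ** q $ i))"

text \<open>For tangent \<open>v\<close> the matrix \<open>v $ i ** transpose (q $ i)\<close> is
  skew, so \<open>q $ i ** transpose (g $ i) ** q $ i\<close> pairs with \<open>v $ i\<close> to
  minus the pairing of \<open>g $ i\<close>. Half the difference therefore pairs as
  \<open>g $ i\<close> does.\<close>

lemma riem_grad_reduced_alignments:
  fixes q :: "real^'d^'d^'m::{finite,linorder}"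
  assumes q: "q \<in> reduced_alignments" and f: "(f has_derivative (\<lambda>v. g \<bullet> v)) (at q)"
  shows "riem_grad reduced_alignments f q = tangent_part q g"
proof (rule riem_grad_eqI)
  have orth: "q $ i ** transpose (q $ i) = mat 1" "transpose (q $ i) ** q $ i = mat 1"
    if "i \<noteq> first_view" for i
    using q that by (auto simp: reduced_alignments_def orthogonal_matrix_def)
  show "tangent_part q g \<in> tangent_space reduced_alignments q"
    unfolding tangent_space_reduced_alignments[OF q]
  proof (clarsimp simp: tangent_part_def)
    fix i :: 'm assume i: "i \<noteq> first_view"
    have "q $ i ** transpose (q $ i ** transpose (g $ i) ** q $ i) = g $ i ** transpose (q $ i)"
      by (simp add: matrix_transpose_mul matrix_mul_assoc orth[OF i])
    moreover have "q $ i ** transpose (g $ i) ** q $ i ** transpose (q $ i) = q $ i ** transpose (g $ i)"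
      by (simp add: matrix_mul_assoc[symmetric] orth[OF i])
    ultimately show "(1 / 2) *\<^sub>R (g $ i - q $ i ** transpose (g $ i) ** q $ i) ** transpose (q $ i) +
      q $ i ** transpose ((1 / 2) *\<^sub>R (g $ i - q $ i ** transpose (g $ i) ** q $ i)) = 0"
      by (simp add: matmul.scaleR_left matmul.scaleR_right transpose_scalar transpose_diff
          matmul.diff_left matmul.diff_right algebra_simps)
  qed
  fix v assume "v \<in> tangent_space reduced_alignments q"
  then have v: "v $ first_view = 0"
    "\<And>i. i \<noteq> first_view \<Longrightarrow> q $ i ** transpose (v $ i) = - (v $ i ** transpose (q $ i))"
    unfolding tangent_space_reduced_alignments[OF q] by (auto simp: eq_neg_iff_add_eq_0 add.commute)
  have "g $ i \<bullet> v $ i = tangent_part q g $ i \<bullet> v $ i" for i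
  proof (cases "i = first_view")
    case False
    have "(q $ i ** transpose (g $ i) ** q $ i) \<bullet> v $ i =
        trace (q $ i ** transpose (g $ i) ** (q $ i ** transpose (v $ i)))"
      by (simp add: inner_matrix_eq_trace matrix_mul_assoc)
    also have "\<dots> = - trace ((q $ i ** transpose (g $ i) ** v $ i) ** transpose (q $ i))"
      by (simp add: v(2)[OF False] matmul.minus_right linear_neg[OF linear_trace] matrix_mul_assoc)
    also have "\<dots> = - trace (transpose (q $ i) ** (q $ i ** transpose (g $ i) ** v $ i))"
      by (subst trace_mul_sym) (rule refl)
    also have "\<dots> = - trace (transpose (g $ i) ** v $ i)"
      by (simp add: matrix_mul_assoc orth[OF False])
    also have "\<dots> = - (g $ i \<bullet> v $ i)"
      by (subst trace_mul_sym) (simp add: inner_matrix_eq_trace[symmetric] inner_commute)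
    finally show ?thesis using False
      by (simp add: tangent_part_def inner_diff_left)
  qed (simp add: v)
  then have "g \<bullet> v = tangent_part q g \<bullet> v" by (simp add: inner_vec_def[where 'b='m])
  then show "frechet_derivative f (at q) v = tangent_part q g \<bullet> v"
    using frechet_derivative_at[OF f] by metis
qed

text \<open>The formula is polynomial in \<open>q\<close> and \<open>g q\<close>, so it extends the
  gradient field differentiably to the ambient space.\<close>

lemma tangent_part_differentiable:
  assumes "g differentiable (at p)"
  shows "(\<lambda>q. tangent_part q (g q)) differentiable (at p)"
proof -
  obtain g' where g': "(g has_derivative g') (at p)" using assms by (auto simp: differentiable_def)
  note gi = bounded_linear.has_derivative[OF bounded_linear_vec_nth g']
  note qi = bounded_linear.has_derivative[OF bounded_linear_vec_nth has_derivative_ident]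
  have tr: "bounded_linear (transpose :: real^'a^'a \<Rightarrow> real^'a^'a)"
    by (simp add: linear_conv_bounded_linear[symmetric] linear_transpose)
  note gt = bounded_linear.has_derivative[OF tr gi]
  note prod = matmul.FDERIV[OF matmul.FDERIV[OF qi gt] qi]
  define F where "F = (\<lambda>i q. if i = first_view then 0
    else (1 / 2) *\<^sub>R (g q $ i - q $ i ** transpose (g q $ i) ** q $ i))"
  have "\<exists>D. (F i has_derivative D) (at p)" for i
  proof (cases "i = first_view")
    case False
    show ?thesis
      using has_derivative_scaleR_right[OF has_derivative_diff[OF gi[of i] prod[of i i i]], of "1 / 2"] False
      unfolding F_def by auto
  qed (auto simp: F_def intro: exI[of _ "\<lambda>_. 0"])
  then obtain D where "\<And>i. (F i has_derivative D i) (at p)"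
    by metis
  from has_derivative_vec_lambda[OF this] show ?thesis
    unfolding tangent_part_def F_def by (rule differentiableI)
qed

section \<open>Euclidean gradient of the reduced objective\<close>

text \<open>The bilinear form whose quadratic form is the objective; the product rule for it yields
  the derivative.\<close>

definition objective_form ::
  "('n::finite, 'm::finite, 'd::finite) patch_framework \<Rightarrow> real^'d^'d^'m \<Rightarrow> real^'d^'d^'m \<Rightarrow> real" where
  "objective_form \<Theta> S T = (Cmat \<Theta> ** stack S) \<bullet> stack T"

lemma objective_eq_form: "objective \<Theta> S = objective_form \<Theta> S S"
  by (simp add: objective_def objective_form_def inner_matrix_eq_trace)

lemma linear_stack: "linear stack"
  by (simp add: linear_iff stack_def vec_eq_iff)

lemma bounded_bilinear_objective_form: "bounded_bilinear (objective_form \<Theta>)"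
  unfolding bilinear_conv_bounded_bilinear[symmetric] bilinear_def linear_iff objective_form_def
  by (simp add: linear_add[OF linear_stack] linear_cmul[OF linear_stack] matmul.add_right
      matmul.scaleR_right inner_add_left inner_add_right)

lemma reduced_objective_has_gradient:
  fixes \<Theta> :: "('n::finite, 'm::{finite,linorder}, 'd::finite) patch_framework"
  obtains g where
    "\<And>q. (reduced_objective \<Theta> has_derivative (\<lambda>v. g q \<bullet> v)) (at q)"
    "\<And>q. g differentiable (at q)"
proof -
  \<comment> \<open>The reduced objective is the quadratic form composed with the affine map
    \<open>ins\<close>, whose linear part is \<open>P\<close>.\<close>
  define ins :: "real^'d^'d^'m::{finite,linorder} \<Rightarrow> real^'d^'d^'m::{finite,linorder}"
    where "ins = (\<lambda>q. \<chi> i. if i = first_view then mat 1 else q $ i)"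
  define P :: "real^'d^'d^'m::{finite,linorder} \<Rightarrow> real^'d^'d^'m::{finite,linorder}"
    where "P = (\<lambda>q. \<chi> i. if i = first_view then 0 else q $ i)"
  interpret b: bounded_bilinear "objective_form \<Theta>" by (rule bounded_bilinear_objective_form)
  define D where "D = (\<lambda>q h. objective_form \<Theta> (ins q) (P h) + objective_form \<Theta> (P h) (ins q))"
  \<comment> \<open>The vector representing the linear functional \<open>D q\<close>, written in the
    standard basis.\<close>
  define g :: "real^'d^'d^'m::{finite,linorder} \<Rightarrow> real^'d^'d^'m::{finite,linorder}" where "g = (\<lambda>q. \<Sum>e\<in>Basis. D q e *\<^sub>R e)"
  have linP: "linear P" by (simp add: P_def linear_iff vec_eq_iff)
  have "((\<lambda>q. if i = first_view then mat 1 else q $ i) has_derivative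
      (\<lambda>h. if i = first_view then 0 else h $ i)) (at q)" for q :: "real^'d^'d^'m::{finite,linorder}" and i
    by (cases "i = first_view") (auto intro: bounded_linear_imp_has_derivative)
  from has_derivative_vec_lambda[OF this]
  have ins: "(ins has_derivative P) (at q)" for q by (simp add: ins_def P_def)
  have red: "reduced_objective \<Theta> = (\<lambda>q. objective_form \<Theta> (ins q) (ins q))"
    by (simp add: fun_eq_iff reduced_objective_def objective_eq_form ins_def)
  have lin: "linear (D q)" for q
    unfolding D_def linear_iff
    by (simp add: linear_add[OF linP] linear_cmul[OF linP] b.add_left b.add_right b.scaleR_left
        b.scaleR_right algebra_simps)
  have "D q v = g q \<bullet> v" for q v
  proof -
    have "D q v = D q (\<Sum>e\<in>Basis. (v \<bullet> e) *\<^sub>R e)" by (simp add: euclidean_representation)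
    also have "\<dots> = (\<Sum>e\<in>Basis. (v \<bullet> e) *\<^sub>R D q e)"
      by (simp add: linear_sum[OF lin] linear_cmul[OF lin])
    also have "\<dots> = g q \<bullet> v" by (simp add: g_def inner_sum_left inner_commute[of v] mult.commute)
    finally show ?thesis .
  qed
  then have "D q = (\<lambda>v. g q \<bullet> v)" for q by (simp add: fun_eq_iff)
  moreover have "(reduced_objective \<Theta> has_derivative D q) (at q)" for q
    unfolding red D_def by (rule b.FDERIV[OF ins ins])
  ultimately have "(reduced_objective \<Theta> has_derivative (\<lambda>v. g q \<bullet> v)) (at q)" for q by metis
  moreover have "g differentiable (at q)" for q
  proof -
    have "(\<lambda>q. D q e) differentiable (at q)" for e
      using has_derivative_add[OF bounded_linear.has_derivative[OF b.bounded_linear_left ins]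
          bounded_linear.has_derivative[OF b.bounded_linear_right ins]]
      unfolding D_def by (rule differentiableI)
    then show ?thesis unfolding g_def
      by (intro differentiable_sum) (auto intro!: differentiable_scaleR)
  qed
  ultimately show ?thesis using that by blast
qed

section \<open>Rotating one side of a partition\<close>

text \<open>The reduced objective is nonnegative on the ambient space, so each point of the curve is
  a global minimiser there. The Euclidean gradient, and with it its tangent part, vanishes along the
  curve.\<close>

lemma riem_hess_reduced_objective_zero:
  fixes \<Theta> :: "('n::finite, 'm::{finite,linorder}, 'd::finite) patch_framework"
    and \<gamma> :: "real \<Rightarrow> real^'d^'d^'m::{finite,linorder}"
  assumes conn: "graph_connected \<Theta>"
    and \<gamma>: "\<And>t. \<gamma> t \<in> reduced_alignments" "\<gamma> 0 = p" "(\<gamma> has_vector_derivative v) (at 0)"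
    and zero: "\<And>t. reduced_objective \<Theta> (\<gamma> t) = 0"
  shows "riem_hess reduced_alignments (reduced_objective \<Theta>) p v = 0"
proof -
  obtain g where g: "\<And>q. (reduced_objective \<Theta> has_derivative (\<lambda>v. g q \<bullet> v)) (at q)"
    "\<And>q. g differentiable (at q)"
    using reduced_objective_has_gradient[of \<Theta>] by blast
  have nonneg: "reduced_objective \<Theta> q \<ge> 0" for q
    unfolding reduced_objective_def by (rule objective_nonneg[OF conn])
  have "(\<lambda>v. g (\<gamma> t) \<bullet> v) = (\<lambda>v. 0)" for t
    by (rule has_derivative_local_min[OF g(1)]) (simp add: zero nonneg)
  then have "g (\<gamma> t) = 0" for t by (metis inner_eq_zero_iff)
  then have "tangent_part (\<gamma> t) (g (\<gamma> t)) = 0" for t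
    by (simp add: tangent_part_def transpose_zero vec_eq_iff[where 'b='m])
  then show ?thesis
    using \<gamma> riem_grad_reduced_alignments[OF _ g(1)] tangent_part_differentiable[OF g(2)]
    by (intro riem_hess_eq_zero[where G = "\<lambda>q. tangent_part q (g q)" and \<gamma> = \<gamma>]) auto
qed

text \<open>A rank deficit of two leaves nonzero orthogonal vectors \<open>u\<close> and
  \<open>v\<close>, both orthogonal to \<open>W\<close>. The infinitesimal rotation in their plane
  kills \<open>W\<close> and sends \<open>v\<close> to a nonzero multiple of
  \<open>u\<close>.\<close>

lemma skew_matrix_vanishing_on:
  fixes W :: "(real^'d) set"
  assumes "dim W + 2 \<le> CARD('d)"
  obtains K :: "real^'d^'d" where "transpose K = - K" "K \<noteq> 0" "\<And>w. w \<in> W \<Longrightarrow> K *v w = 0"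
proof -
  obtain u where u: "u \<noteq> 0" "\<And>w. w \<in> span W \<Longrightarrow> orthogonal u w"
    using orthogonal_to_subspace_exists[of W] assms by auto
  have "dim (insert u W) < DIM(real^'d)" using assms by (simp add: dim_insert)
  then obtain v where v: "v \<noteq> 0" "\<And>w. w \<in> span (insert u W) \<Longrightarrow> orthogonal v w"
    using orthogonal_to_subspace_exists[of "insert u W"] by blast
  define K where "K = outer u v - outer v u"
  have uv: "u \<bullet> v = 0"
    using v(2)[of u] by (simp add: orthogonal_def span_base inner_commute)
  have "K *v v = (v \<bullet> v) *\<^sub>R u"
    by (simp add: K_def matvec.diff_left outer_mul_vector uv)
  then have "K \<noteq> 0" using u(1) v(1) by auto
  moreover have "transpose K = - K"
    by (simp add: K_def transpose_diff transpose_outer)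
  moreover have "K *v w = 0" if "w \<in> W" for w
    using u(2)[of w] v(2)[of w] that
    by (simp add: K_def matvec.diff_left outer_mul_vector orthogonal_def span_base)
  ultimately show ?thesis using that by blast
qed

lemma mul_edge_vec: "Z *v edge_vec k i = column (Inl k) Z - column (Inr i) Z"
  by (simp add: edge_vec_def matvec.diff_right matrix_vector_mult_basis)

lemma objective_eq_0_if_placement:
  fixes \<Theta> :: "('n::finite, 'm::finite, 'd::finite) patch_framework"
  assumes conn: "graph_connected \<Theta>"
    and p: "\<And>k i. (k, i) \<in> edges \<Theta> \<Longrightarrow> transpose (S $ i) *v coord \<Theta> k i = p (Inl k) - p (Inr i)"
  shows "objective \<Theta> S = 0"
proof (rule objective_eq_0I[OF conn])
  have "column c (\<chi> r c. p c $ r) = p c" for c by (simp add: column_def vec_eq_iff)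
  then show "transpose (S $ i) *v coord \<Theta> k i = (\<chi> r c. p c $ r) *v edge_vec k i"
    if "(k, i) \<in> edges \<Theta>" for k i
    using p[OF that] by (simp add: mul_edge_vec)
qed

text \<open>The views in \<open>A\<close> and the points they see are rotated about
  \<open>y\<close>. A point also seen from outside \<open>A\<close> stays put because
  \<open>K\<close> kills its offset from \<open>y\<close>, so every local view remains
  realised.\<close>

lemma degenerate_if_skew_matrix:
  fixes \<Theta> :: "('n::finite, 'm::{finite,linorder}, 'd::finite) patch_framework"
    and S :: "real^'d^'d^'m::{finite,linorder}"
  assumes conn: "graph_connected \<Theta>" and al: "alignment S"
    and p: "\<And>k i. (k, i) \<in> edges \<Theta> \<Longrightarrow> transpose (S $ i) *v coord \<Theta> k i = p (Inl k) - p (Inr i)"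
    and A: "A \<noteq> {}" "first_view \<notin> A"
    and K: "transpose K = - K" "K \<noteq> 0"
      "\<And>k. k \<in> overlap \<Theta> A (- A) \<Longrightarrow> K *v (p (Inl k) - y) = 0"
  shows "\<not> hess_nonsingular reduced_alignments (reduced_objective \<Theta>) (quotient_map S)"
proof -
  have orth: "S $ i ** transpose (S $ i) = mat 1" "transpose (S $ i) ** S $ i = mat 1" for i
    using al by (auto simp: alignment_def orthogonal_matrix_def)
  obtain R where R: "\<And>t. orthogonal_matrix (R t)" "R 0 = mat 1" "(R has_vector_derivative K) (at 0)"
    "\<And>t x. K *v x = 0 \<Longrightarrow> R t *v x = x"
    using rotation_curve[OF K(1)] by blast
  define S1 where "S1 = S $ first_view"
  have S1: "S1 ** transpose S1 = mat 1" "transpose S1 ** S1 = mat 1" using orth by (auto simp: S1_def)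
  \<comment> \<open>This is the quotient map applied to \<open>S\<close> with \<open>S $ i\<close>
    replaced by \<open>S $ i ** transpose (R t)\<close> for \<open>i\<close> in \<open>A\<close>.
    The normalising block \<open>S1\<close> is constant since the first view lies outside
    \<open>A\<close>.\<close>
  define \<gamma> where "\<gamma> = (\<lambda>t. \<chi> i. if i = first_view then 0
      else if i \<in> A then S $ i ** transpose (R t) ** transpose S1 else S $ i ** transpose S1)"
  define v where "v = (\<chi> i. if i \<in> A then S $ i ** transpose K ** transpose S1 else 0)"
  have "orthogonal_matrix (S $ i)" "orthogonal_matrix (transpose S1)" "orthogonal_matrix (transpose (R t))" for i t
    using al R(1) by (auto simp: alignment_def S1_def)
  then have mem: "\<gamma> t \<in> reduced_alignments" for t
    by (auto simp: reduced_alignments_def \<gamma>_def intro!: orthogonal_matrix_mul)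
  have \<gamma>0: "\<gamma> 0 = quotient_map S"
    by (simp add: \<gamma>_def quotient_map_def R(2) S1_def vec_eq_iff[where 'b='m])
  have "((\<lambda>t. if i = first_view then 0
      else if i \<in> A then S $ i ** transpose (R t) ** transpose S1 else S $ i ** transpose S1)
      has_vector_derivative (if i \<in> A then S $ i ** transpose K ** transpose S1 else 0)) (at 0)" for i
  proof (cases "i \<in> A")
    case True
    have "bounded_linear (\<lambda>M. S $ i ** transpose M ** transpose S1)"
      unfolding linear_conv_bounded_linear[symmetric] linear_iff
      by (simp add: transpose_add transpose_scalar matmul.add_right matmul.add_left
          matmul.scaleR_left matmul.scaleR_right)
    from bounded_linear.has_vector_derivative[OF this R(3)] show ?thesis
      using True A(2) by (cases "i = first_view") auto
  qed (cases "i = first_view", auto)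
  then have der: "(\<gamma> has_vector_derivative v) (at 0)"
    unfolding \<gamma>_def v_def by (rule has_vector_derivative_vec_lambda)
  have zero: "reduced_objective \<Theta> (\<gamma> t) = 0" for t
    unfolding reduced_objective_def
  proof (rule objective_eq_0_if_placement[OF conn])
    \<comment> \<open>\<open>move\<close> is the rotation about \<open>y\<close>. The placement
      \<open>q\<close> applies it to the views in \<open>A\<close> and to every point seen by one of
      them; the factor \<open>S1\<close> passes to the frame in which the first view has block
      \<open>mat 1\<close>.\<close>
    define move where "move = (\<lambda>z. R t *v (z - y) + y)"
    define q :: "'n + 'm \<Rightarrow> real^'d" where
      "q = case_sum (\<lambda>k. S1 *v (if \<exists>i\<in>A. (k, i) \<in> edges \<Theta> then move (p (Inl k)) else p (Inl k)))
         (\<lambda>i. S1 *v (if i \<in> A then move (p (Inr i)) else p (Inr i)))"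
    fix k i assume e: "(k, i) \<in> edges \<Theta>"
    let ?U = "(\<chi> i. if i = first_view then mat 1 else \<gamma> t $ i) $ i"
    show "transpose ?U *v coord \<Theta> k i = q (Inl k) - q (Inr i)"
    proof (cases "i \<in> A")
      case True
      then have "transpose ?U = S1 ** R t ** transpose (S $ i)"
        using A(2) by (auto simp: \<gamma>_def matrix_transpose_mul matrix_mul_assoc)
      then have "transpose ?U *v coord \<Theta> k i = S1 *v (R t *v (p (Inl k) - p (Inr i)))"
        by (simp add: matrix_vector_mul_assoc[symmetric] p[OF e])
      also have "\<dots> = S1 *v (move (p (Inl k)) - move (p (Inr i)))"
        by (simp add: move_def matvec.diff_right)
      also have "\<dots> = q (Inl k) - q (Inr i)"
        using True e by (auto simp: q_def matvec.diff_right)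
      finally show ?thesis .
    next
      case False
      \<comment> \<open>At the first view this reads \<open>mat 1 = S1 ** transpose S1\<close>, so
        the same formula covers all views outside \<open>A\<close>.\<close>
      have "?U = S $ i ** transpose S1"
        using False by (simp add: \<gamma>_def S1_def orth)
      then have "transpose ?U = S1 ** transpose (S $ i)"
        by (simp add: matrix_transpose_mul)
      then have *: "transpose ?U *v coord \<Theta> k i = S1 *v (p (Inl k) - p (Inr i))"
        by (simp add: matrix_vector_mul_assoc[symmetric] p[OF e])
      \<comment> \<open>A point seen both by view \<open>i\<close> and by a view in \<open>A\<close>
        lies in the overlap, where the rotation is trivial.\<close>
      have "move (p (Inl k)) = p (Inl k)" if "\<exists>i\<in>A. (k, i) \<in> edges \<Theta>"
      proof -
        have "k \<in> overlap \<Theta> A (- A)" using that e False by (auto simp: overlap_def)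
        then show ?thesis using R(4)[OF K(3)] by (simp add: move_def)
      qed
      then show ?thesis using False unfolding * by (auto simp: q_def matvec.diff_right)
    qed
  qed
  have "riem_hess reduced_alignments (reduced_objective \<Theta>) (quotient_map S) v = 0"
    by (rule riem_hess_reduced_objective_zero[OF conn mem \<gamma>0 der zero])
  moreover have "v \<in> tangent_space reduced_alignments (quotient_map S)"
    by (rule tangent_spaceI[OF mem \<gamma>0 der])
  moreover have "v \<noteq> 0"
  proof
    assume "v = 0"
    obtain i where "i \<in> A" using A(1) by blast
    have "v $ i = 0" using \<open>v = 0\<close> by simp
    then have "S $ i ** transpose K ** transpose S1 = 0" using \<open>i \<in> A\<close> by (simp add: v_def)
    \<comment> \<open>Multiplying by invertible matrices on both sides recovers
      \<open>transpose K\<close> from the block.\<close>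
    then have "transpose (S $ i) ** (S $ i ** transpose K ** transpose S1) ** S1 = 0"
      by (simp add: matmul.zero_left matmul.zero_right)
    also have "transpose (S $ i) ** (S $ i ** transpose K ** transpose S1) ** S1 = transpose K"
      by (metis S1(2) orth(2) matrix_mul_assoc matrix_mul_lid matrix_mul_rid)
    finally show False using K(1,2) by simp
  qed
  ultimately show ?thesis unfolding hess_nonsingular_def by blast
qed

section \<open>From overlap matrices to placements\<close>

text \<open>Centring subtracts the mean of the columns, which serves as \<open>\<mu>\<close> and
  later as the centre of rotation. For the empty list the claim is vacuous.\<close>

lemma centred_contains_translate:
  obtains \<mu> where "\<And>x. x \<in> set X \<Longrightarrow> x - \<mu> \<in> set (centred X)"
proof
  let ?\<mu> = "\<Sum>l<length X. (1 / real (length X)) *\<^sub>R X ! l"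
  fix x assume "x \<in> set X"
  then obtain j where j: "j < length X" "x = X ! j" by (auto simp: in_set_conv_nth)
  have "(\<Sum>l<length X. ((if l = j then 1 else 0) - 1 / real (length X)) *\<^sub>R X ! l) =
      (\<Sum>l<length X. if l = j then X ! l else 0) - ?\<mu>"
    unfolding sum_subtractf[symmetric] by (rule sum.cong) (auto simp: scaleR_diff_left)
  also have "\<dots> = x - ?\<mu>" using j by simp
  finally show "x - ?\<mu> \<in> set (centred X)"
    using j by (force simp: centred_def Let_def)
qed

text \<open>\<open>Hmat\<close> is the optimal placement with the centroid \<open>c\<close> of its
  point columns subtracted from every column. Differences along edges are unchanged, and column
  \<open>Inr i\<close> becomes the translation of view \<open>i\<close>.\<close>

lemma perfect_alignment_placement:
  fixes \<Theta> :: "('n::{finite,linorder}, 'm::finite, 'd::finite) patch_framework"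
  assumes conn: "graph_connected \<Theta>" and S: "perfect_alignment \<Theta> S"
  obtains p :: "'n + 'm \<Rightarrow> real^'d" where
    "\<And>k i. (k, i) \<in> edges \<Theta> \<Longrightarrow> transpose (S $ i) *v coord \<Theta> k i = p (Inl k) - p (Inr i)"
    "\<And>A B. overlap_matrix \<Theta> S A B = map (\<lambda>k. p (Inl k)) (sorted_list_of_set (overlap \<Theta> A B))"
proof -
  define Z where "Z = opt_placement \<Theta> S"
  define c where "c = (1 / real CARD('n)) *\<^sub>R (Z *v point_indicator)"
  define p where "p = (\<lambda>u. column u Z - c)"
  have "Hmat \<Theta> S = Z - outer c 1"
    by (simp add: Hmat_def Z_def opt_placement_def c_def matmul.diff_right matmul.scaleR_right
        matrix_mul_outer outer.scaleR_left)
  then have t: "translation \<Theta> S i = p (Inr i)" for i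
    by (simp add: translation_def p_def column_def outer_def vec_eq_iff)
  have e: "transpose (S $ i) *v coord \<Theta> k i = p (Inl k) - p (Inr i)"
    if "(k, i) \<in> edges \<Theta>" for k i
    using objective_eq_0_imp[OF conn _ that, of S] S
    by (simp add: perfect_alignment_def Z_def[symmetric] mul_edge_vec p_def)
  show ?thesis
  proof (rule that[OF e])
    fix A B
    have "(let i = SOME i. i \<in> A \<and> (k, i) \<in> edges \<Theta>
        in transpose (S $ i) *v coord \<Theta> k i + translation \<Theta> S i) = p (Inl k)"
      if "k \<in> overlap \<Theta> A B" for k
    proof -
      have "\<exists>i. i \<in> A \<and> (k, i) \<in> edges \<Theta>" using that by (auto simp: overlap_def)
      \<comment> \<open>The edge equation gives \<open>p (Inl k)\<close> for any view of the point,
        so only membership of the chosen edge matters.\<close>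
      then have "(k, SOME i. i \<in> A \<and> (k, i) \<in> edges \<Theta>) \<in> edges \<Theta>"
        by (rule someI2_ex) simp
      then show ?thesis by (simp add: e t Let_def)
    qed
    then show "overlap_matrix \<Theta> S A B = map (\<lambda>k. p (Inl k)) (sorted_list_of_set (overlap \<Theta> A B))"
      by (simp add: overlap_matrix_def)
  qed
qed

theorem theorem4p5:
  fixes \<Theta> :: "('n::{finite,linorder}, 'm::{finite,linorder}, 'd::finite) patch_framework"
    and S :: "real^'d^'d^'m::{finite,linorder}"
  assumes "graph_connected \<Theta>"
    and "\<forall>i. affinely_nondegenerate \<Theta> i"
    and "perfect_alignment \<Theta> S"
    and "nondegenerate \<Theta> S"
  shows "\<forall>A B. A \<noteq> {} \<and> B \<noteq> {} \<and> A \<inter> B = {} \<and> A \<union> B = UNIV \<longrightarrow>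
           int (list_rank (centred (overlap_matrix \<Theta> S A B))) \<ge> int CARD('d) - 1"
proof (intro allI impI)
  fix A B :: "'m set"
  assume AB: "A \<noteq> {} \<and> B \<noteq> {} \<and> A \<inter> B = {} \<and> A \<union> B = UNIV"
  define X where "X = overlap_matrix \<Theta> S A B"
  obtain p where p: "\<And>k i. (k, i) \<in> edges \<Theta> \<Longrightarrow> transpose (S $ i) *v coord \<Theta> k i = p (Inl k) - p (Inr i)"
    "\<And>A B. overlap_matrix \<Theta> S A B = map (\<lambda>k. p (Inl k)) (sorted_list_of_set (overlap \<Theta> A B))"
    using perfect_alignment_placement[OF assms(1,3)] by blast
  \<comment> \<open>The side without the first view is the one to be rotated; the overlap is
    symmetric in the two sides.\<close>
  define C where "C = (if first_view \<in> A then B else A)"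
  have C: "C \<noteq> {}" "first_view \<notin> C" using AB by (auto simp: C_def)
  have "B = - A" using AB by auto
  then have "overlap \<Theta> C (- C) = overlap \<Theta> A B" by (auto simp: C_def overlap_def)
  then have X: "p (Inl k) \<in> set X" if "k \<in> overlap \<Theta> C (- C)" for k
    using that by (simp add: X_def p(2))
  obtain \<mu> where \<mu>: "\<And>x. x \<in> set X \<Longrightarrow> x - \<mu> \<in> set (centred X)"
    using centred_contains_translate by blast
  \<comment> \<open>Over the integers, rank below \<open>d - 1\<close> means rank plus 2 at most
    \<open>d\<close>; the additive form avoids truncated subtraction.\<close>
  have "\<not> dim (set (centred X)) + 2 \<le> CARD('d)"
  proof
    assume "dim (set (centred X)) + 2 \<le> CARD('d)"
    then obtain K :: "real^'d^'d" where K: "transpose K = - K" "K \<noteq> 0"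
      "\<And>w. w \<in> set (centred X) \<Longrightarrow> K *v w = 0"
      using skew_matrix_vanishing_on by blast
    have "alignment S" using assms(3) by (simp add: perfect_alignment_def)
    then have "\<not> hess_nonsingular reduced_alignments (reduced_objective \<Theta>) (quotient_map S)"
      by (rule degenerate_if_skew_matrix[OF assms(1) _ p(1) C K(1,2) K(3)[OF \<mu>[OF X]]])
    then show False using assms(4) by (simp add: nondegenerate_def)
  qed
  then show "int (list_rank (centred (overlap_matrix \<Theta> S A B))) \<ge> int CARD('d) - 1"
    by (simp add: list_rank_def X_def)
qed

end
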